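(* Let $k\ge 1$ be an integer, let $\Omega\subset\mathbb{R}^d$ be an open convex set and let $f:\Omega\to\mathbb{R}$ be a continuous function. Then $f$ has bounded finite differences of order $k$ (i.e. $|||\Delta^k f|||_\Omega<+\infty$) if and only if $f$ is of class $C^{k-1}$ with Lipschitz derivative $D^{k-1}f$ of order $k-1$. Furthermore, in that case, $|||\Delta^k f|||_\Omega=\mathrm{Lip}(D^{k-1}f)$.
   Context: Fix a norm $\|\cdot\|$ on $\mathbb{R}^d$. For $v\in\mathbb{R}^d$, $\Delta_v f(x)=f(x+v)-f(x)$. For $u=(u_1,\dots,u_k)\in(\mathbb{R}^d)^k$, $\Delta^k_u=\Delta_{u_1}\circ\cdots\circ\Delta_{u_k}$, so that $\Delta^k_uf(x)=\sum_{\alpha\in\{0,1\}^k}(-1)^{k-(\alpha_1+\cdots+\alpha_k)}f(x+\alpha\cdot u)$ with $\alpha\cdot u=\alpha_1u_1+\cdots+\alpha_ku_k$; it is defined at the points of $\Omega^u=\{x\in\Omega: x+\alpha\cdot u\in\Omega\text{ for all }\alpha\in\{0,1\}^k\}$. Put $\|u\|^k:=\|u_1\|\cdots\|u_k\|$ (a product) and $$|||\Delta^k f|||_\Omega=\sup_{u\in(\mathbb{R}^d\setminus\{0\})^k}\frac{1}{\|u\|^k}\sup_{x\in\Omega^u}|\Delta^k_uf(x)|\in[0,+\infty],$$ where the supremum over the empty set is $0$. $D^{k-1}f$ (with $D^0f=f$) takes values in the symmetric $(k-1)$-multilinear maps $\xi$ on $\mathbb{R}^d$, normed by $\|\xi\|=\sup|\xi(u_1,\dots,u_{k-1})|/(\|u_1\|\cdots\|u_{k-1}\|)$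 over nonzero vectors; $\mathrm{Lip}$ denotes the least Lipschitz constant. *)

theory Defs
  imports "HOL-Analysis.Analysis"
begin

text \<open>
  The norm \<open>N\<close> is an arbitrary norm, not the Euclidean one of the type class. All norms on
  \<open>real^'d\<close> are equivalent, so the library's notions of openness, continuity and Frechet
  differentiability are the ones induced by \<open>N\<close>; the quantities that depend on the choice of the
  norm are stated with \<open>N\<close>.
\<close>

definition is_norm :: "(real^'d \<Rightarrow> real) \<Rightarrow> bool" where
  "is_norm N \<longleftrightarrow>
     (\<forall>x. 0 \<le> N x) \<and>
     (\<forall>x. N x = 0 \<longleftrightarrow> x = 0) \<and>
     (\<forall>c x. N (c *\<^sub>R x) = \<bar>c\<bar> * N x) \<and>
     (\<forall>x y. N (x + y) \<le> N x + N y)"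

text \<open>Tuples \<open>(u_1, ..., u_k)\<close> of vectors are lists of length \<open>k\<close>.\<close>

definition nonzero_tuples :: "nat \<Rightarrow> (real^'d) list set" where
  "nonzero_tuples k = {us. length us = k \<and> 0 \<notin> set us}"

definition norm_prod :: "(real^'d \<Rightarrow> real) \<Rightarrow> (real^'d) list \<Rightarrow> real" where
  "norm_prod N us = prod_list (map N us)"

definition diff_op :: "real^'d \<Rightarrow> (real^'d \<Rightarrow> real) \<Rightarrow> real^'d \<Rightarrow> real" where
  "diff_op v f = (\<lambda>x. f (x + v) - f x)"

definition fin_diff :: "(real^'d) list \<Rightarrow> (real^'d \<Rightarrow> real) \<Rightarrow> real^'d \<Rightarrow> real" where
  "fin_diff us f = foldr diff_op us f"

definition bits :: "nat \<Rightarrow> nat list set" where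
  "bits k = {\<alpha>. length \<alpha> = k \<and> set \<alpha> \<subseteq> {0, 1}}"

definition bit_comb :: "nat list \<Rightarrow> (real^'d) list \<Rightarrow> real^'d" where
  "bit_comb \<alpha> us = sum_list (map2 (\<lambda>a u. real a *\<^sub>R u) \<alpha> us)"

definition fin_diff_dom :: "(real^'d) set \<Rightarrow> (real^'d) list \<Rightarrow> (real^'d) set" where
  "fin_diff_dom \<Omega> us = {x \<in> \<Omega>. \<forall>\<alpha> \<in> bits (length us). x + bit_comb \<alpha> us \<in> \<Omega>}"

text \<open>
  The explicit formula for iterated differences. In particular, on \<open>fin_diff_dom \<Omega> us\<close> they depend
  only on the values of \<open>f\<close> in \<open>\<Omega>\<close>.
\<close>

lemma bits_0: "bits 0 = {[]}"
  by (auto simp: bits_def)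

lemma bits_Suc: "bits (Suc k) = (#) 0 ` bits k \<union> (#) 1 ` bits k"
  by (auto simp: bits_def length_Suc_conv image_iff)

lemma finite_bits: "finite (bits k)"
  by (induction k) (auto simp: bits_0 bits_Suc)

lemma sum_list_bits_le: "\<alpha> \<in> bits k \<Longrightarrow> sum_list \<alpha> \<le> k"
  by (induction k arbitrary: \<alpha>) (fastforce simp: bits_0 bits_Suc)+

lemma fin_diff_expand:
  "fin_diff us f x =
     (\<Sum>\<alpha>\<in>bits (length us). (-1) ^ (length us - sum_list \<alpha>) * f (x + bit_comb \<alpha> us))"
proof (induction us arbitrary: x)
  case Nil
  show ?case by (simp add: fin_diff_def bits_0 bit_comb_def)
next
  case (Cons u us)
  let ?k = "length us"
  have inj: "inj_on ((#) (a::nat)) A" for a A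
    by (simp add: inj_on_def)
  have disj: "(#) (0::nat) ` bits ?k \<inter> (#) (Suc 0) ` bits ?k = {}"
    by auto
  have "fin_diff (u # us) f x = fin_diff us f (x + u) - fin_diff us f x"
    by (simp add: fin_diff_def diff_op_def)
  also have "\<dots> = (\<Sum>\<alpha>\<in>bits ?k. (-1) ^ (?k - sum_list \<alpha>) * f (x + u + bit_comb \<alpha> us)) +
       (\<Sum>\<alpha>\<in>bits ?k. (-1) ^ (Suc ?k - sum_list \<alpha>) * f (x + bit_comb \<alpha> us))"
    by (simp add: Cons.IH Suc_diff_le sum_list_bits_le sum_negf cong: sum.cong)
  also have "\<dots> = (\<Sum>\<alpha>\<in>bits (Suc ?k). (-1) ^ (Suc ?k - sum_list \<alpha>) * f (x + bit_comb \<alpha> (u # us)))"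
    by (simp add: bits_Suc sum.union_disjoint[OF _ _ disj] finite_bits sum.reindex[OF inj]
        bit_comb_def add_ac)
  finally show ?case by simp
qed

text \<open>
  In \<open>ennreal\<close> the supremum of the empty set is \<open>0\<close>.
\<close>

definition fin_diff_norm ::
    "(real^'d \<Rightarrow> real) \<Rightarrow> nat \<Rightarrow> (real^'d) set \<Rightarrow> (real^'d \<Rightarrow> real) \<Rightarrow> ennreal" where
  "fin_diff_norm N k \<Omega> f =
     (SUP us \<in> nonzero_tuples k.
        ennreal (1 / norm_prod N us) * (SUP x \<in> fin_diff_dom \<Omega> us. ennreal \<bar>fin_diff us f x\<bar>))"

text \<open>
  \<open>iter_deriv f x\<close> represents all derivatives of \<open>f\<close> at \<open>x\<close>: restricted to lists of length \<open>m\<close> it is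
  the \<open>m\<close>-linear map \<open>D^m f(x)\<close>. The recursion is the usual \<open>D^{m+1} f = D (D^m f)\<close>, evaluated at
  a tuple of vectors.
\<close>

fun iter_deriv :: "(real^'d \<Rightarrow> real) \<Rightarrow> real^'d \<Rightarrow> (real^'d) list \<Rightarrow> real" where
  "iter_deriv f x [] = f x"
| "iter_deriv f x (v # vs) = frechet_derivative (\<lambda>y. iter_deriv f y vs) (at x) v"

text \<open>
  \<open>f\<close> is of class \<open>C^m\<close> on the open set \<open>\<Omega>\<close>: for \<open>j < m\<close> the map \<open>D^j f\<close> is (Frechet) differentiable on
  \<open>\<Omega>\<close>, and \<open>D^m f\<close> is continuous on \<open>\<Omega>\<close>. A map into the finite-dimensional space of \<open>j\<close>-linear maps
  is differentiable or continuous if and only if its evaluations at all tuples are.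
\<close>

definition class_C :: "nat \<Rightarrow> (real^'d) set \<Rightarrow> (real^'d \<Rightarrow> real) \<Rightarrow> bool" where
  "class_C m \<Omega> f \<longleftrightarrow>
     (\<forall>j<m. \<forall>us. length us = j \<longrightarrow> (\<forall>x\<in>\<Omega>. (\<lambda>y. iter_deriv f y us) differentiable (at x))) \<and>
     (\<forall>us. length us = m \<longrightarrow> continuous_on \<Omega> (\<lambda>y. iter_deriv f y us))"

text \<open>Norm of an \<open>m\<close>-linear map; for \<open>m = 0\<close> it is the absolute value of \<open>\<xi> []\<close>.\<close>

definition multilin_norm ::
    "(real^'d \<Rightarrow> real) \<Rightarrow> nat \<Rightarrow> ((real^'d) list \<Rightarrow> real) \<Rightarrow> ennreal" where
  "multilin_norm N m \<xi> = (SUP us \<in> nonzero_tuples m. ennreal (\<bar>\<xi> us\<bar> / norm_prod N us))"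

definition is_lipschitz_const ::
    "(real^'d \<Rightarrow> real) \<Rightarrow> nat \<Rightarrow> (real^'d) set \<Rightarrow> (real^'d \<Rightarrow> (real^'d) list \<Rightarrow> real) \<Rightarrow> real \<Rightarrow> bool"
  where
  "is_lipschitz_const N m \<Omega> G L \<longleftrightarrow>
     0 \<le> L \<and>
     (\<forall>x\<in>\<Omega>. \<forall>y\<in>\<Omega>. multilin_norm N m (\<lambda>us. G x us - G y us) \<le> ennreal (L * N (x - y)))"

definition is_lipschitz ::
    "(real^'d \<Rightarrow> real) \<Rightarrow> nat \<Rightarrow> (real^'d) set \<Rightarrow> (real^'d \<Rightarrow> (real^'d) list \<Rightarrow> real) \<Rightarrow> bool" where
  "is_lipschitz N m \<Omega> G \<longleftrightarrow> (\<exists>L. is_lipschitz_const N m \<Omega> G L)"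

text \<open>The infimum is attained if \<open>G\<close> is Lipschitz; otherwise it is \<open>\<infinity>\<close>.\<close>

definition Lip ::
    "(real^'d \<Rightarrow> real) \<Rightarrow> nat \<Rightarrow> (real^'d) set \<Rightarrow> (real^'d \<Rightarrow> (real^'d) list \<Rightarrow> real) \<Rightarrow> ennreal" where
  "Lip N m \<Omega> G = (INF L \<in> {L. is_lipschitz_const N m \<Omega> G L}. ennreal L)"

end

theory Submission
  imports Defs
begin


text \<open>
  For every real \<open>M \<ge> 0\<close>, the bound \<open>\<bar>\<Delta>_u f\<bar> \<le> M \<parallel>u_1\<parallel> \<dots> \<parallel>u_k\<parallel>\<close> on all \<open>k\<close>-fold differences holds if
  and only if \<open>f\<close> is of class \<open>C^{k-1}\<close> and \<open>D^{k-1} f\<close> has Lipschitz constant \<open>M\<close>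
  (\<open>fin_diff_norm_le_iff_lipschitz\<close>). As both sides hold for the same \<open>M\<close>, the equivalence and the
  equality of the optimal constants follow together.

  From derivatives to differences, a mean value theorem (\<open>fin_diff_mean_value\<close>) replaces \<open>k - 1\<close> of
  the \<open>k\<close> differences by derivatives at one common point \<open>z\<close>, and the last one becomes
  \<open>D^{k-1} f(z + w) - D^{k-1} f(z)\<close>. Convexity keeps \<open>z\<close> and \<open>z + w\<close> in the domain.

  The converse is an induction on \<open>k\<close>. Once \<open>f\<close> is known to be \<open>C^1\<close>, dividing a \<open>k\<close>-fold difference
  by the length of one step and letting this step shrink shows that \<open>\<partial>_v f\<close> has \<open>(k-1)\<close>-fold
  differences bounded with constant \<open>M N(v)\<close> (\<open>fin_diff_bound_derivative\<close>). No constant is lost, so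
  the induction gives the sharp Lipschitz constant. That \<open>f\<close> is \<open>C^1\<close> is a local and purely
  qualitative question, for which constants are irrelevant and the Euclidean norm serves. Two uses
  of one elementary inequality, which compares \<open>n \<Delta>_h\<close> with \<open>\<Delta>_{nh}\<close> (\<open>multiple_step_estimate\<close>),
  answer it. First, it bounds \<open>m\<close>-fold differences locally in terms of \<open>(m+1)\<close>-fold ones and of \<open>\<bar>f\<bar>\<close>
  (\<open>local_diff_bound_descent\<close>), which reduces the order to \<open>2\<close>. Second, for bounded second
  differences, it makes the quotients \<open>n (f(a + v/n) - f(a))\<close> converge with a quadratic error; the
  limit is additive in \<open>v\<close> and locally bounded, hence linear, which makes it the derivative
  (\<open>second_diff_bound_imp_differentiable\<close>).
\<close>

section \<open>Iterated differences and their domains\<close>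

lemma diff_op_commute: "diff_op u (diff_op v f) = diff_op v (diff_op u f)"
  by (simp add: diff_op_def fun_eq_iff algebra_simps)

lemma fin_diff_Nil [simp]: "fin_diff [] f = f"
  by (simp add: fin_diff_def)

lemma fin_diff_Cons: "fin_diff (u # us) f x = fin_diff us f (x + u) - fin_diff us f x"
  by (simp add: fin_diff_def diff_op_def)

lemma fin_diff_middle: "fin_diff (us @ v # vs) f = diff_op v (fin_diff (us @ vs) f)"
proof (induction us)
  case Nil
  show ?case by (simp add: fin_diff_def)
next
  case (Cons u us)
  have "fin_diff ((u # us) @ v # vs) f = diff_op u (fin_diff (us @ v # vs) f)"
    by (simp add: fin_diff_def)
  also have "\<dots> = diff_op v (diff_op u (fin_diff (us @ vs) f))"
    by (simp add: Cons.IH diff_op_commute)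
  also have "diff_op u (fin_diff (us @ vs) f) = fin_diff ((u # us) @ vs) f"
    by (simp add: fin_diff_def)
  finally show ?case .
qed

lemma fin_diff_zero_direction: "0 \<in> set us \<Longrightarrow> fin_diff us f x = 0"
  by (auto simp: fin_diff_middle diff_op_def dest!: split_list)

lemma fin_diff_dom_Nil: "fin_diff_dom \<Omega> [] = \<Omega>"
  by (auto simp: fin_diff_dom_def bits_0 bit_comb_def)

text \<open>
  Cutting the parallelepiped into two opposite faces makes the domain recursive, in step with
  \<open>fin_diff_Cons\<close>; openness and convexity are inherited through this recursion.
\<close>

lemma fin_diff_dom_Cons:
  "fin_diff_dom \<Omega> (u # us) = {x \<in> fin_diff_dom \<Omega> us. x + u \<in> fin_diff_dom \<Omega> us}"
proof -
  have zero: "\<exists>\<alpha>\<in>bits (length us). bit_comb \<alpha> us = 0" for us :: "(real^'a) list"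
  proof (induction us)
    case (Cons u us)
    then obtain \<alpha> where "\<alpha> \<in> bits (length us)" "bit_comb \<alpha> us = 0" by blast
    then have "0 # \<alpha> \<in> bits (length (u # us))" "bit_comb (0 # \<alpha>) (u # us) = 0"
      by (auto simp: bits_Suc bit_comb_def)
    then show ?case by blast
  qed (auto simp: bits_0 bit_comb_def)
  have "x + u \<in> \<Omega>" if "\<forall>\<alpha>\<in>bits (length us). x + u + bit_comb \<alpha> us \<in> \<Omega>" for x
    using that zero[of us] by force
  then show ?thesis
    by (auto simp: fin_diff_dom_def bits_Suc ball_Un bit_comb_def add.assoc)
qed

lemma fin_diff_dom_snoc:
  "fin_diff_dom \<Omega> (us @ [v]) = {x \<in> fin_diff_dom \<Omega> us. x + v \<in> fin_diff_dom \<Omega> us}"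
  by (induction us) (auto simp: fin_diff_dom_Nil fin_diff_dom_Cons algebra_simps)

lemma open_fin_diff_dom: "open \<Omega> \<Longrightarrow> open (fin_diff_dom \<Omega> us)"
proof (induction us)
  case (Cons u us)
  have "fin_diff_dom \<Omega> (u # us) = fin_diff_dom \<Omega> us \<inter> (\<lambda>x. x + u) -` fin_diff_dom \<Omega> us"
    by (auto simp: fin_diff_dom_Cons)
  then show ?case
    using Cons by (auto intro!: open_Int open_vimage continuous_intros)
qed (simp add: fin_diff_dom_Nil)

lemma convex_fin_diff_dom: "convex \<Omega> \<Longrightarrow> convex (fin_diff_dom \<Omega> us)"
proof (induction us)
  case (Cons u us)
  have "fin_diff_dom \<Omega> (u # us) = fin_diff_dom \<Omega> us \<inter> (+) (- u) ` fin_diff_dom \<Omega> us"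
    by (force simp: fin_diff_dom_Cons image_iff)
  then show ?case
    using Cons by (simp add: convex_Int convex_translation)
qed (simp add: fin_diff_dom_Nil)

lemma cball_subset_fin_diff_dom:
  assumes "cball a r \<subseteq> \<Omega>" "dist a x + sum_list (map norm us) \<le> r"
  shows "x \<in> fin_diff_dom \<Omega> us"
  using assms(2)
proof (induction us arbitrary: x)
  case Nil
  then show ?case using assms(1) by (auto simp: fin_diff_dom_Nil)
next
  case (Cons u us)
  have "dist a (x + u) \<le> dist a x + norm u"
    by (metis dist_triangle add_diff_cancel_left' dist_norm norm_minus_commute)
  then have "x + u \<in> fin_diff_dom \<Omega> us" "x \<in> fin_diff_dom \<Omega> us"
    using Cons.prems norm_ge_zero[of u] by (intro Cons.IH; simp; linarith)+
  then show ?case by (simp add: fin_diff_dom_Cons)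
qed

section \<open>A mean value theorem for iterated differences\<close>

lemma iter_deriv_append:
  "iter_deriv f x (us @ vs) = iter_deriv (\<lambda>y. iter_deriv f y vs) x us"
  by (induction us arbitrary: x) auto

lemma fin_diff_has_derivative:
  assumes "\<And>y. y \<in> \<Omega> \<Longrightarrow> (f has_derivative f' y) (at y)" and "x \<in> fin_diff_dom \<Omega> us"
  shows "(fin_diff us f has_derivative (\<lambda>v. fin_diff us (\<lambda>y. f' y v) x)) (at x)"
  using assms(2)
proof (induction us arbitrary: x)
  case Nil
  then show ?case using assms(1)[of x] by (simp add: fin_diff_dom_Nil)
next
  case (Cons u us)
  then have "x \<in> fin_diff_dom \<Omega> us" "x + u \<in> fin_diff_dom \<Omega> us"
    by (auto simp: fin_diff_dom_Cons)
  note D = this[THEN Cons.IH]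
  have "((\<lambda>y. fin_diff us f (y + u)) has_derivative (\<lambda>v. fin_diff us (\<lambda>y. f' y v) (x + u))) (at x)"
    using has_derivative_compose[OF has_derivative_add_const[OF has_derivative_ident] D(2)] by simp
  from has_derivative_diff[OF this D(1)] show ?case
    by (simp add: fin_diff_Cons fun_eq_iff[of "fin_diff (u # us) f"] fin_diff_Cons[abs_def])
qed

text \<open>
  The increment of \<open>\<Delta>_u f\<close> by \<open>w\<close> is treated as a single function along the edge from \<open>x\<close> to
  \<open>x + u_1\<close>. The one-dimensional mean value theorem turns the difference in \<open>u_1\<close> into a derivative
  taken at the same parameter in both copies of the edge, and the statement applies again to
  \<open>\<partial>_{u_1} f\<close> and the remaining steps. Derivatives accumulate at the end of the argument list of
  \<open>iter_deriv\<close>, hence the reversal.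
\<close>

lemma fin_diff_mean_value:
  assumes "convex \<Omega>"
    and "\<And>vs y. length vs < length us \<Longrightarrow> y \<in> \<Omega> \<Longrightarrow> (\<lambda>z. iter_deriv f z vs) differentiable (at y)"
    and "x \<in> fin_diff_dom \<Omega> us" "x + w \<in> fin_diff_dom \<Omega> us"
  shows "\<exists>z\<in>\<Omega>. z + w \<in> \<Omega> \<and>
    fin_diff us f (x + w) - fin_diff us f x = iter_deriv f (z + w) (rev us) - iter_deriv f z (rev us)"
  using assms(2-)
proof (induction us arbitrary: f x)
  case Nil
  then show ?case by (auto simp: fin_diff_dom_Nil)
next
  case (Cons u us)
  let ?D = "fin_diff_dom \<Omega> us" and ?F = "fin_diff us f" and ?g = "\<lambda>y. iter_deriv f y [u]"
  have cD: "convex ?D" using assms(1) by (rule convex_fin_diff_dom)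
  have f': "(f has_derivative frechet_derivative f (at y)) (at y)" if "y \<in> \<Omega>" for y
    using Cons.prems(1)[of "[]" y] that by (simp flip: frechet_derivative_works)
  have xs: "x \<in> ?D" "x + u \<in> ?D" "x + w \<in> ?D" "x + u + w \<in> ?D"
    using Cons.prems(2,3) by (auto simp: fin_diff_dom_Cons algebra_simps)
  have on_edge: "x + t *\<^sub>R u \<in> ?D" "x + t *\<^sub>R u + w \<in> ?D" if "0 \<le> t" "t \<le> 1" for t
  proof -
    have "(1 - t) *\<^sub>R x + t *\<^sub>R (x + u) \<in> ?D" "(1 - t) *\<^sub>R (x + w) + t *\<^sub>R (x + u + w) \<in> ?D"
      using that xs by (auto intro!: convexD[OF cD])
    then show "x + t *\<^sub>R u \<in> ?D" "x + t *\<^sub>R u + w \<in> ?D"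
      by (simp_all add: algebra_simps)
  qed
  define \<phi> where "\<phi> t = ?F (x + t *\<^sub>R u + w) - ?F (x + t *\<^sub>R u)" for t
  define d where "d t = fin_diff us ?g (x + t *\<^sub>R u + w) - fin_diff us ?g (x + t *\<^sub>R u)" for t
  have d\<phi>: "(\<phi> has_derivative (\<lambda>s. s * d t)) (at t)" if t: "0 \<le> t" "t \<le> 1" for t
  proof -
    have lin: "linear (\<lambda>v. fin_diff us (\<lambda>y. frechet_derivative f (at y) v) z)" if "z \<in> ?D" for z
      using fin_diff_has_derivative[OF f' that] has_derivative_linear by blast
    have "((\<lambda>t. ?F (x + t *\<^sub>R u + w)) has_derivative
             (\<lambda>s. fin_diff us (\<lambda>y. frechet_derivative f (at y) (s *\<^sub>R u)) (x + t *\<^sub>R u + w))) (at t)"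
      by (rule has_derivative_compose[OF _ fin_diff_has_derivative[OF f']])
         (auto intro!: derivative_eq_intros on_edge t)
    moreover have "((\<lambda>t. ?F (x + t *\<^sub>R u)) has_derivative
             (\<lambda>s. fin_diff us (\<lambda>y. frechet_derivative f (at y) (s *\<^sub>R u)) (x + t *\<^sub>R u))) (at t)"
      by (rule has_derivative_compose[OF _ fin_diff_has_derivative[OF f']])
         (auto intro!: derivative_eq_intros on_edge t)
    ultimately have "(\<phi> has_derivative
        (\<lambda>s. fin_diff us (\<lambda>y. frechet_derivative f (at y) (s *\<^sub>R u)) (x + t *\<^sub>R u + w)
           - fin_diff us (\<lambda>y. frechet_derivative f (at y) (s *\<^sub>R u)) (x + t *\<^sub>R u))) (at t)"
      unfolding \<phi>_def by (rule has_derivative_diff)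
    then show ?thesis
      by (simp add: d_def lin[OF on_edge(1)[OF t], THEN linear_scale]
          lin[OF on_edge(2)[OF t], THEN linear_scale] right_diff_distrib)
  qed
  then obtain t where t: "0 < t" "t < 1" "\<phi> 1 - \<phi> 0 = d t"
    using mvt_simple[of 0 1 \<phi> "\<lambda>t s. s * d t", OF _ has_derivative_at_withinI[OF d\<phi>]] by auto
  have "\<exists>z\<in>\<Omega>. z + w \<in> \<Omega> \<and> fin_diff us ?g (x + t *\<^sub>R u + w) - fin_diff us ?g (x + t *\<^sub>R u)
          = iter_deriv ?g (z + w) (rev us) - iter_deriv ?g z (rev us)"
  proof (rule Cons.IH)
    fix vs :: "(real^'a) list" and y
    assume "length vs < length us" "y \<in> \<Omega>"
    then show "(\<lambda>z. iter_deriv ?g z vs) differentiable at y"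
      using Cons.prems(1)[of "vs @ [u]" y] by (simp add: iter_deriv_append)
  qed (use on_edge t in auto)
  moreover have "fin_diff (u # us) f (x + w) - fin_diff (u # us) f x = d t"
    using t(3) by (simp add: fin_diff_Cons \<phi>_def add_ac)
  ultimately show ?case by (simp add: d_def iter_deriv_append)
qed

section \<open>Lowering the order of local bounds on differences\<close>

lemma norm_prod_Nil [simp]: "norm_prod N [] = 1"
  by (simp add: norm_prod_def)

lemma norm_prod_Cons [simp]: "norm_prod N (u # us) = N u * norm_prod N us"
  by (simp add: norm_prod_def)

lemma norm_prod_append [simp]: "norm_prod N (us @ vs) = norm_prod N us * norm_prod N vs"
  by (simp add: norm_prod_def)

lemma norm_prod_rev [simp]: "norm_prod N (rev us) = norm_prod N us"
  by (induction us) auto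

lemma norm_prod_nonneg: "(\<And>v. 0 \<le> N v) \<Longrightarrow> 0 \<le> norm_prod N us"
  by (induction us) auto

lemma norm_prod_le_one: "sum_list (map norm us) \<le> 1 \<Longrightarrow> norm_prod norm us \<le> 1"
proof (induction us)
  case (Cons u us)
  have "0 \<le> sum_list (map norm us)" by (rule sum_list_nonneg) auto
  then have "norm u \<le> 1" "norm_prod norm us \<le> 1"
    using Cons.prems norm_ge_zero[of u] by (auto intro!: Cons.IH simp del: norm_ge_zero)
  then show ?case by (simp add: mult_le_one norm_prod_nonneg)
qed simp

text \<open>
  \<open>\<Delta>_{nh} W(x)\<close> telescopes into the \<open>n\<close> differences \<open>\<Delta>_h W(x + ih)\<close>, and each of them deviates from
  \<open>\<Delta>_h W(x)\<close> by the second difference with steps \<open>h\<close> and \<open>ih\<close>. A first difference with a short step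
  is thus \<open>1/n\<close> times one with a long step, up to second differences.
\<close>

lemma multiple_step_estimate:
  assumes "\<And>i. i < n \<Longrightarrow> \<bar>diff_op h (diff_op (real i *\<^sub>R h) W) x\<bar> \<le> e"
  shows "\<bar>real n * diff_op h W x - diff_op (real n *\<^sub>R h) W x\<bar> \<le> real n * e"
proof -
  have "diff_op (real n *\<^sub>R h) W x = (\<Sum>i<n. diff_op h W (x + real i *\<^sub>R h))"
    by (induction n) (simp_all add: diff_op_def algebra_simps)
  then have "diff_op (real n *\<^sub>R h) W x - real n * diff_op h W x
           = (\<Sum>i<n. diff_op h W (x + real i *\<^sub>R h) - diff_op h W x)"
    by (simp add: sum_subtractf)
  also have "\<dots> = (\<Sum>i<n. diff_op h (diff_op (real i *\<^sub>R h) W) x)"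
    by (simp add: diff_op_def algebra_simps)
  finally have "\<bar>diff_op (real n *\<^sub>R h) W x - real n * diff_op h W x\<bar>
      \<le> (\<Sum>i<n. \<bar>diff_op h (diff_op (real i *\<^sub>R h) W) x\<bar>)"
    by simp
  also have "\<dots> \<le> real n * e"
    using sum_bounded_above[of "{..<n}" "\<lambda>i. \<bar>diff_op h (diff_op (real i *\<^sub>R h) W) x\<bar>" e] assms
    by simp
  finally show ?thesis by (simp add: abs_minus_commute)
qed

text \<open>
  The condition on \<open>x\<close> and \<open>us\<close> confines all vertices of the parallelepiped to a ball around \<open>a\<close>, and
  it is insensitive to the order of the steps.
\<close>

definition local_diff_bound :: "nat \<Rightarrow> (real^'d \<Rightarrow> real) \<Rightarrow> real^'d \<Rightarrow> bool" where
  "local_diff_bound m f a \<longleftrightarrow> (\<exists>C\<ge>0. \<exists>r>0. \<forall>us x.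
     length us = m \<longrightarrow> dist a x + sum_list (map norm us) \<le> r \<longrightarrow> \<bar>fin_diff us f x\<bar> \<le> C * norm_prod norm us)"

lemma fin_diff_bounded:
  assumes "\<And>x. x \<in> cball a r \<Longrightarrow> \<bar>f x\<bar> \<le> B" "dist a x + sum_list (map norm us) \<le> r"
  shows "\<bar>fin_diff us f x\<bar> \<le> 2 ^ length us * B"
  using assms(2)
proof (induction us arbitrary: x)
  case Nil
  then show ?case using assms(1)[of x] by simp
next
  case (Cons u us)
  have "dist a (x + u) \<le> dist a x + norm u"
    by (metis dist_triangle add_diff_cancel_left' dist_norm norm_minus_commute)
  then have "\<bar>fin_diff us f (x + u)\<bar> \<le> 2 ^ length us * B" "\<bar>fin_diff us f x\<bar> \<le> 2 ^ length us * B"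
    using Cons.prems norm_ge_zero[of u] by (intro Cons.IH; simp; linarith)+
  then show ?case by (simp add: fin_diff_Cons)
qed

text \<open>
  Passing from \<open>(k+1)\<close>-fold to \<open>k\<close>-fold differences, the steps are gained one by one: \<open>us\<close> contains
  the steps that already appear in the bound, \<open>vs\<close> those that do not yet. For \<open>j = 0\<close> the bound only
  expresses that \<open>f\<close> is bounded. To gain a step \<open>h\<close>, take \<open>n\<close> such that \<open>n h\<close> has roughly the size of
  the radius. Then \<open>\<Delta>_h = \<Delta>_{nh} / n\<close> up to \<open>(k+1)\<close>-fold differences, the bound already known applies
  to \<open>\<Delta>_{nh}\<close>, and \<open>1/n\<close> is comparable to the norm of \<open>h\<close>. Lengthening the step
  costs half of the radius.
\<close>

lemma local_diff_bound_peel: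
  assumes C: "0 \<le> C" and r: "0 < r" "r \<le> 1"
    and bd: "\<And>us x. length us = Suc k \<Longrightarrow> dist a x + sum_list (map norm us) \<le> r \<Longrightarrow>
               \<bar>fin_diff us f x\<bar> \<le> C * norm_prod norm us"
    and B: "\<And>x. x \<in> cball a r \<Longrightarrow> \<bar>f x\<bar> \<le> B"
    and "j \<le> k"
  shows "\<exists>K\<ge>0. \<exists>\<rho>>0. \<rho> \<le> r \<and> (\<forall>us vs x. length us = j \<longrightarrow> length vs = k - j \<longrightarrow>
           dist a x + sum_list (map norm (us @ vs)) \<le> \<rho> \<longrightarrow>
           \<bar>fin_diff (us @ vs) f x\<bar> \<le> K * norm_prod norm us)"
  using \<open>j \<le> k\<close>
proof (induction j)
  case 0
  have "\<bar>f a\<bar> \<le> B" using B[of a] r by simp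
  then have "0 \<le> B" by linarith
  then have "0 \<le> 2 ^ k * B" by simp
  moreover have "\<bar>fin_diff vs f x\<bar> \<le> 2 ^ k * B"
    if "length vs = k" "dist a x + sum_list (map norm vs) \<le> r" for vs x
    using fin_diff_bounded[where f = f and B = B, OF B that(2)] that(1) by simp
  ultimately show ?case using r
    by (intro exI[of _ "2 ^ k * B"] conjI exI[of _ r]) auto
next
  case (Suc j)
  then obtain K \<rho> where K: "0 \<le> K" and \<rho>: "0 < \<rho>" "\<rho> \<le> r"
    and IH: "\<And>us vs x. length us = j \<Longrightarrow> length vs = k - j \<Longrightarrow>
           dist a x + sum_list (map norm (us @ vs)) \<le> \<rho> \<Longrightarrow>
           \<bar>fin_diff (us @ vs) f x\<bar> \<le> K * norm_prod norm us"
    by (meson Suc_leD)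
  define \<sigma> where "\<sigma> = \<rho> / 2"
  have \<sigma>: "0 < \<sigma>" "\<sigma> \<le> 1" "2 * \<sigma> = \<rho>" using \<rho> r by (auto simp: \<sigma>_def)
  define K' where "K' = 2 * K / \<sigma> + C"
  have "\<bar>fin_diff (us @ vs) f x\<bar> \<le> K' * norm_prod norm us"
    if us: "length us = Suc j" and vs: "length vs = k - Suc j"
      and small: "dist a x + sum_list (map norm (us @ vs)) \<le> \<sigma>" for us vs x
  proof -
    obtain us' h where us': "us = us' @ [h]" "length us' = j"
      using us by (metis length_Suc_conv_rev)
    show ?thesis
    proof (cases "h = 0")
      case True
      then show ?thesis by (simp add: us' fin_diff_zero_direction norm_prod_def)
    next
      case False
      define W where "W = fin_diff (us' @ vs) f"
      define P where "P = norm_prod norm us'"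
      define s where "s = dist a x + sum_list (map norm us') + sum_list (map norm vs)"
      have nn: "0 \<le> sum_list (map norm zs)" for zs :: "(real^'a) list"
        by (rule sum_list_nonneg) auto
      have s0: "0 \<le> s" and s: "s + norm h \<le> \<sigma>"
        using small nn[of us'] nn[of vs] by (auto simp: s_def us')
      have P: "0 \<le> P" by (simp add: P_def norm_prod_nonneg)
      have Pvs: "norm_prod norm vs \<le> 1" "0 \<le> norm_prod norm vs"
        using small nn[of us] \<sigma> zero_le_dist[of a x]
        by (auto intro!: norm_prod_le_one simp: norm_prod_nonneg simp del: zero_le_dist)
      have P': "norm_prod norm (us' @ vs) \<le> P"
        using mult_left_mono[OF Pvs(1) P] by (simp add: P_def)
      have h: "0 < norm h" "norm h \<le> \<sigma>" using False s s0 by auto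
      \<comment> \<open>The largest \<open>n\<close> for which \<open>n h\<close> has norm at most \<open>\<sigma>\<close>; it also makes that norm at least \<open>\<sigma> / 2\<close>.\<close>
      define n where "n = nat \<lfloor>\<sigma> / norm h\<rfloor>"
      have q1: "1 \<le> \<sigma> / norm h" using h by simp
      have n: "real n \<le> \<sigma> / norm h" "\<sigma> / norm h < real n + 1" "1 \<le> n"
        using q1 of_int_floor_le[of "\<sigma> / norm h"] floor_correct[of "\<sigma> / norm h"]
          le_nat_floor[of 1 "\<sigma> / norm h"] by (simp_all add: n_def)
      have n_upper: "real n * norm h \<le> \<sigma>"
        using n(1) h by (simp add: pos_le_divide_eq)
      have "\<sigma> \<le> (real n + 1) * norm h"
        using n(2) h by (simp add: pos_divide_less_eq)
      also have "\<dots> \<le> (2 * real n) * norm h"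
        using n(3) h by (intro mult_right_mono) auto
      finally have n_lower: "\<sigma> \<le> 2 * (real n * norm h)" by simp
      have "\<bar>real n * diff_op h W x - diff_op (real n *\<^sub>R h) W x\<bar> \<le> real n * (C * (norm h * \<sigma> * P))"
      proof (rule multiple_step_estimate)
        fix i assume "i < n"
        then have "real i * norm h \<le> real n * norm h - norm h"
          using h mult_right_mono[of "real i + 1" "real n" "norm h"] by (simp add: algebra_simps)
        then have ih: "real i * norm h \<le> \<sigma>" "norm h + real i * norm h \<le> \<sigma>"
          using n_upper h by linarith+
        have "diff_op h (diff_op (real i *\<^sub>R h) W) x = fin_diff (h # (real i *\<^sub>R h) # us' @ vs) f x"
          by (simp add: W_def fin_diff_def)
        also have "\<bar>\<dots>\<bar> \<le> C * norm_prod norm (h # (real i *\<^sub>R h) # us' @ vs)"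
          using us us' vs Suc.prems ih s \<sigma> \<rho> by (intro bd) (auto simp: s_def)
        also have "\<dots> = C * (norm h * (real i * norm h) * norm_prod norm (us' @ vs))"
          by simp
        also have "\<dots> \<le> C * (norm h * \<sigma> * P)"
          using C h ih P P' Pvs \<sigma> by (intro mult_left_mono mult_mono) (auto simp: norm_prod_nonneg)
        finally show "\<bar>diff_op h (diff_op (real i *\<^sub>R h) W) x\<bar> \<le> C * (norm h * \<sigma> * P)" .
      qed
      moreover have "\<bar>diff_op (real n *\<^sub>R h) W x\<bar> \<le> K * P"
      proof -
        \<comment> \<open>The long step lies among the uncounted ones, where its length does not enter the bound.\<close>
        have room: "s + real n * norm h \<le> \<rho>"
          using n_upper s h \<sigma> by linarith
        have "diff_op (real n *\<^sub>R h) W x = fin_diff (us' @ (real n *\<^sub>R h) # vs) f x"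
          by (simp add: W_def fin_diff_middle)
        also have "\<bar>\<dots>\<bar> \<le> K * norm_prod norm us'"
          using us us' vs Suc.prems room by (intro IH) (auto simp: s_def)
        finally show ?thesis by (simp add: P_def)
      qed
      ultimately have "real n * \<bar>diff_op h W x\<bar> \<le> K * P + real n * (C * (norm h * \<sigma> * P))"
        using abs_mult[of "real n" "diff_op h W x"] by (simp only: abs_of_nat)
      also have "\<dots> \<le> real n * (K' * (P * norm h))"
      proof -
        have "\<sigma> * (K * P) \<le> 2 * (real n * norm h) * (K * P)"
          using n_lower K P by (intro mult_right_mono) auto
        then have "K * P \<le> real n * (2 * K / \<sigma> * (P * norm h))"
          using \<sigma> by (simp add: field_simps)
        moreover have "real n * (C * (norm h * \<sigma> * P)) \<le> real n * (C * (norm h * 1 * P))"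
          using \<sigma> C P by (intro mult_left_mono mult_right_mono) auto
        ultimately show ?thesis by (simp add: K'_def algebra_simps)
      qed
      finally have "\<bar>diff_op h W x\<bar> \<le> K' * (P * norm h)"
        using n(3) by simp
      then show ?thesis by (simp add: us' W_def P_def fin_diff_middle)
    qed
  qed
  moreover have "0 \<le> K'" using K C \<sigma> by (simp add: K'_def)
  ultimately show ?case using \<sigma> \<rho>
    by (intro exI[of _ K'] conjI exI[of _ \<sigma>]) auto
qed

lemma local_diff_bound_descent:
  assumes "local_diff_bound (Suc k) f a" "isCont f a"
  shows "local_diff_bound k f a"
proof -
  obtain C r where C: "0 \<le> C" and r: "0 < r"
    and bd: "\<And>us x. length us = Suc k \<Longrightarrow> dist a x + sum_list (map norm us) \<le> r \<Longrightarrow>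
               \<bar>fin_diff us f x\<bar> \<le> C * norm_prod norm us"
    using assms(1) by (auto simp: local_diff_bound_def)
  obtain s where s: "0 < s" "\<And>x. dist x a < s \<Longrightarrow> dist (f x) (f a) < 1"
    using assms(2)[unfolded continuous_at_eps_delta] zero_less_one by blast
  define \<rho> where "\<rho> = min 1 (min r (s / 2))"
  have \<rho>: "0 < \<rho>" "\<rho> \<le> 1" "\<rho> \<le> r" "\<rho> < s"
    using r s(1) by (auto simp: \<rho>_def)
  have B: "\<bar>f x\<bar> \<le> \<bar>f a\<bar> + 1" if "x \<in> cball a \<rho>" for x
    using s(2)[of x] that \<rho> by (auto simp: dist_commute dist_real_def)
  from local_diff_bound_peel[of C \<rho> k a f, OF C \<rho>(1,2) bd B order_refl]
  obtain K \<sigma> where "0 \<le> K" "0 < \<sigma>" "\<And>us x. length us = k \<Longrightarrow>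
           dist a x + sum_list (map norm us) \<le> \<sigma> \<Longrightarrow> \<bar>fin_diff us f x\<bar> \<le> K * norm_prod norm us"
    using \<rho> by auto
  then show ?thesis by (auto simp: local_diff_bound_def)
qed

lemma local_diff_bound_antimono:
  assumes "m \<le> k" "local_diff_bound k f a" "isCont f a"
  shows "local_diff_bound m f a"
  using assms by (induction rule: inc_induct) (auto intro: local_diff_bound_descent)

section \<open>Differentiability from second differences\<close>

text \<open>
  An additive map is homogeneous for integer scalars. For real \<open>c\<close>, splitting \<open>n c\<close> into its integer
  part \<open>p\<close> and a rest \<open>s\<close> in the unit interval gives \<open>n (A(cv) - c A(v)) = A(sv) - s A(v)\<close>, which stays bounded as \<open>n\<close>
  grows.
\<close>

lemma additive_bounded_imp_linear:
  fixes A :: "'a::real_normed_vector \<Rightarrow> real"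
  assumes add: "\<And>u v. A (u + v) = A u + A v"
    and r: "0 < r" and bd: "\<And>v. norm v \<le> r \<Longrightarrow> \<bar>A v\<bar> \<le> B"
  shows "linear A"
proof (rule linearI)
  fix c :: real and v :: 'a
  have A0: "A 0 = 0" using add[of 0 0] by simp
  have nat: "A (real n *\<^sub>R u) = real n * A u" for n u
    by (induction n) (simp_all add: A0 add algebra_simps)
  have minus: "A (- u) = - A u" for u
    using add[of u "- u"] A0 by simp
  have int: "A (of_int p *\<^sub>R u) = of_int p * A u" for p u
  proof (cases p rule: int_cases2)
    case (nonneg n)
    then show ?thesis using nat[of n u] by simp
  next
    case (nonpos n)
    then show ?thesis using nat[of n u] minus[of "real n *\<^sub>R u"] by simp
  qed
  obtain m :: nat where m: "norm v / r < real m"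
    using reals_Archimedean2 by blast
  have "0 < real m" using m r by (smt (verit) divide_nonneg_pos norm_ge_zero)
  have seg: "\<bar>A (s *\<^sub>R v)\<bar> \<le> real m * B" if "\<bar>s\<bar> \<le> 1" for s
  proof -
    have "\<bar>s\<bar> * norm v \<le> 1 * norm v" using that by (intro mult_right_mono) auto
    also have "\<dots> \<le> r * real m" using m r by (simp add: field_simps)
    finally have "norm ((s / real m) *\<^sub>R v) \<le> r"
      using \<open>0 < real m\<close> by (simp add: field_simps)
    then have "real m * \<bar>A ((s / real m) *\<^sub>R v)\<bar> \<le> real m * B"
      by (intro mult_left_mono bd) auto
    then show ?thesis
      using nat[of m "(s / real m) *\<^sub>R v"] \<open>0 < real m\<close> by (simp add: abs_mult)
  qed
  have "real n * \<bar>A (c *\<^sub>R v) - c * A v\<bar> \<le> real m * B + \<bar>A v\<bar>" for n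
  proof -
    define p where "p = \<lfloor>real n * c\<rfloor>"
    define s where "s = real n * c - of_int p"
    have s: "\<bar>s\<bar> \<le> 1" unfolding s_def p_def by linarith
    have "real n *\<^sub>R c *\<^sub>R v = of_int p *\<^sub>R v + s *\<^sub>R v"
      by (simp add: s_def flip: scaleR_add_left)
    then have "real n * A (c *\<^sub>R v) = of_int p * A v + A (s *\<^sub>R v)"
      by (metis nat add int)
    then have "real n * (A (c *\<^sub>R v) - c * A v) = A (s *\<^sub>R v) - s * A v"
      by (simp add: s_def algebra_simps)
    then have "real n * \<bar>A (c *\<^sub>R v) - c * A v\<bar> = \<bar>A (s *\<^sub>R v) - s * A v\<bar>"
      by (metis abs_mult abs_of_nat)
    also have "\<dots> \<le> \<bar>A (s *\<^sub>R v)\<bar> + \<bar>s\<bar> * \<bar>A v\<bar>"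
      using abs_triangle_ineq4[of "A (s *\<^sub>R v)" "s * A v"] by (simp add: abs_mult)
    also have "\<dots> \<le> real m * B + 1 * \<bar>A v\<bar>"
      using seg[OF s] s by (intro add_mono mult_right_mono) auto
    finally show ?thesis by simp
  qed
  then have "\<not> 0 < \<bar>A (c *\<^sub>R v) - c * A v\<bar>"
    using reals_Archimedean3 by (meson not_less)
  then show "A (c *\<^sub>R v) = c *\<^sub>R A v" by simp
qed (rule add)

text \<open>
  Taking \<open>h = v/n\<close> in \<open>multiple_step_estimate\<close> bounds the distance between the quotient
  \<open>q n v = n (f(a + v/n) - f(a))\<close> and the increment \<open>f(a + v) - f(a)\<close> by \<open>C \<parallel>v\<parallel>\<^sup>2\<close>, uniformly in \<open>n\<close>.
  Rescaled, this compares both \<open>q m v\<close> and \<open>q n v\<close> with \<open>q (m n) v\<close>, so the quotients form a Cauchy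
  sequence; in the limit, it is the error estimate of the derivative. Additivity holds because
  \<open>q n (u + v) - q n u - q n v\<close> is \<open>n\<close> times a second difference with steps \<open>u/n\<close> and \<open>v/n\<close>, which
  is of order \<open>1/n\<close>.
\<close>

lemma second_diff_bound_imp_differentiable:
  fixes f :: "real^'d \<Rightarrow> real"
  assumes C: "0 \<le> C" and r: "0 < r"
    and bd: "\<And>u v. norm u + norm v \<le> r \<Longrightarrow> \<bar>diff_op u (diff_op v f) a\<bar> \<le> C * (norm u * norm v)"
    and cont: "isCont f a"
  shows "f differentiable (at a)"
proof -
  define q where "q n v = real n * diff_op ((1 / real n) *\<^sub>R v) f a" for n v
  have q: "\<bar>q n v - diff_op v f a\<bar> \<le> C * (norm v)\<^sup>2" if "norm v \<le> r" "1 \<le> n" for n v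
  proof -
    let ?h = "(1 / real n) *\<^sub>R v"
    have "\<bar>real n * diff_op ?h f a - diff_op (real n *\<^sub>R ?h) f a\<bar> \<le> real n * (C * (norm v)\<^sup>2 / real n)"
    proof (rule multiple_step_estimate)
      fix i assume i: "i < n"
      have "norm ?h + norm (real i *\<^sub>R ?h) = (real i + 1) / real n * norm v"
        by (simp add: add_divide_distrib algebra_simps)
      also have "\<dots> \<le> 1 * norm v"
        using i by (intro mult_right_mono) auto
      finally have "\<bar>diff_op ?h (diff_op (real i *\<^sub>R ?h) f) a\<bar> \<le> C * (norm ?h * norm (real i *\<^sub>R ?h))"
        using that by (intro bd) auto
      also have "\<dots> = C * ((norm v)\<^sup>2 / real n) * (real i / real n)"
        by (simp add: power2_eq_square)
      also have "\<dots> \<le> C * ((norm v)\<^sup>2 / real n) * 1"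
        using i C by (intro mult_left_mono) auto
      finally show "\<bar>diff_op ?h (diff_op (real i *\<^sub>R ?h) f) a\<bar> \<le> C * (norm v)\<^sup>2 / real n"
        by simp
    qed
    then show ?thesis using that by (simp add: q_def)
  qed
  have q_refine: "\<bar>q (m * n) v - q m v\<bar> \<le> C * (norm v)\<^sup>2 / real m"
    if "norm v \<le> real m * r" "1 \<le> m" "1 \<le> n" for m n v
  proof -
    have "norm ((1 / real m) *\<^sub>R v) \<le> r" using that by (simp add: field_simps)
    from q[OF this that(3)]
    have "real m * \<bar>q n ((1 / real m) *\<^sub>R v) - diff_op ((1 / real m) *\<^sub>R v) f a\<bar>
        \<le> real m * (C * (norm ((1 / real m) *\<^sub>R v))\<^sup>2)"
      by (intro mult_left_mono) auto
    also have "\<dots> = C * (norm v)\<^sup>2 / real m"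
      using that by (simp add: power2_eq_square field_simps)
    also have "real m * \<bar>q n ((1 / real m) *\<^sub>R v) - diff_op ((1 / real m) *\<^sub>R v) f a\<bar> = \<bar>q (m * n) v - q m v\<bar>"
      by (simp add: q_def abs_mult[of "real m", simplified, symmetric] right_diff_distrib mult_ac)
    finally show ?thesis .
  qed
  have "Cauchy (\<lambda>n. q n v)" for v
  proof (rule metric_CauchyI)
    fix e :: real assume e: "0 < e"
    define D where "D = C * (norm v)\<^sup>2"
    obtain n0 where n0: "max (norm v / r) (2 * D / e) < real n0"
      using reals_Archimedean2 by blast
    have big: "norm v \<le> real n * r" "2 * D < real n * e" "1 \<le> n" if "n0 \<le> n" for n
    proof -
      have n: "real n0 \<le> real n" using that by simp
      have "norm v / r < real n" "2 * D / e < real n" using n0 n by linarith+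
      then show "norm v \<le> real n * r" "2 * D < real n * e"
        using e r by (auto simp: divide_less_eq)
      have "0 \<le> norm v / r" using r by simp
      then have "0 < real n" using \<open>norm v / r < real n\<close> by linarith
      then show "1 \<le> n" by simp
    qed
    have "dist (q m v) (q n v) < e" if mn: "n0 \<le> m" "n0 \<le> n" for m n
    proof -
      have "\<bar>q (m * n) v - q m v\<bar> \<le> D / real m" "\<bar>q (n * m) v - q n v\<bar> \<le> D / real n"
        using q_refine[of v m n] q_refine[of v n m] big[OF mn(1)] big[OF mn(2)] by (auto simp: D_def)
      moreover have "D / real m < e / 2" "D / real n < e / 2"
        using big[OF mn(1)] big[OF mn(2)] by (auto simp: field_simps)
      ultimately show ?thesis
        by (simp only: dist_real_def mult.commute[of n m])
    qed
    then show "\<exists>M. \<forall>m\<ge>M. \<forall>n\<ge>M. dist (q m v) (q n v) < e" by blast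
  qed
  then have lim: "(\<lambda>n. q n v) \<longlonglongrightarrow> lim (\<lambda>n. q n v)" for v
    by (simp add: Cauchy_convergent convergent_LIMSEQ_iff[symmetric])
  define A where "A v = lim (\<lambda>n. q n v)" for v
  have lim: "(\<lambda>n. q n v) \<longlonglongrightarrow> A v" for v
    using lim by (simp add: A_def)
  have approx: "\<bar>A v - diff_op v f a\<bar> \<le> C * (norm v)\<^sup>2" if "norm v \<le> r" for v
  proof (rule tendsto_upperbound)
    show "(\<lambda>n. \<bar>q n v - diff_op v f a\<bar>) \<longlonglongrightarrow> \<bar>A v - diff_op v f a\<bar>"
      by (intro tendsto_intros lim)
    show "\<forall>\<^sub>F n in sequentially. \<bar>q n v - diff_op v f a\<bar> \<le> C * (norm v)\<^sup>2"
      using q[OF that] by (auto simp: eventually_sequentially)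
  qed auto
  have add: "A (u + v) = A u + A v" for u v
  proof -
    obtain n0 where n0: "(norm u + norm v) / r < real n0"
      using reals_Archimedean2 by blast
    have "\<forall>\<^sub>F n in sequentially. norm (q n (u + v) - q n u - q n v) \<le> C * (norm u * norm v) / real n"
    proof (rule eventually_sequentiallyI[of "max 1 n0"])
      fix n assume "max 1 n0 \<le> n"
      then have n: "1 \<le> n" "real n0 \<le> real n" by auto
      let ?u = "(1 / real n) *\<^sub>R u" and ?v = "(1 / real n) *\<^sub>R v"
      have "(norm u + norm v) / r < real n" using n0 n by linarith
      then have "norm ?u + norm ?v \<le> r"
        using r n by (simp add: field_simps)
      then have "real n * \<bar>diff_op ?u (diff_op ?v f) a\<bar> \<le> real n * (C * (norm ?u * norm ?v))"
        by (intro mult_left_mono bd) auto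
      also have "\<dots> = C * (norm u * norm v) / real n"
        using n by (simp add: field_simps)
      also have "real n * \<bar>diff_op ?u (diff_op ?v f) a\<bar> = norm (q n (u + v) - q n u - q n v)"
      proof -
        have "q n (u + v) - q n u - q n v = real n * diff_op ?u (diff_op ?v f) a"
          by (simp add: q_def diff_op_def algebra_simps)
        then show ?thesis by (simp add: abs_mult)
      qed
      finally show "norm (q n (u + v) - q n u - q n v) \<le> C * (norm u * norm v) / real n" .
    qed
    then have "(\<lambda>n. q n (u + v) - q n u - q n v) \<longlonglongrightarrow> 0"
      by (rule Lim_null_comparison) (rule lim_const_over_n)
    moreover have "(\<lambda>n. q n (u + v) - q n u - q n v) \<longlonglongrightarrow> A (u + v) - A u - A v"
      by (intro tendsto_intros lim)
    ultimately have "A (u + v) - A u - A v = 0"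
      using LIMSEQ_unique by blast
    then show ?thesis by simp
  qed
  obtain s where s: "0 < s" "\<And>x. dist x a < s \<Longrightarrow> dist (f x) (f a) < 1"
    using cont[unfolded continuous_at_eps_delta] zero_less_one by blast
  have "linear A"
  proof (rule additive_bounded_imp_linear[OF add])
    show "0 < min r (s / 2)" using r s by simp
    fix v :: "real^'d" assume v: "norm v \<le> min r (s / 2)"
    then have "\<bar>diff_op v f a\<bar> < 1"
      using s(2)[of "a + v"] s(1) by (simp add: dist_norm diff_op_def)
    moreover have "C * (norm v)\<^sup>2 \<le> C * r\<^sup>2"
      using v C by (intro mult_left_mono power_mono) auto
    ultimately show "\<bar>A v\<bar> \<le> C * r\<^sup>2 + 1"
      using approx[of v] v by auto
  qed
  moreover have "((\<lambda>h. norm (f (a + h) - f a - A h) / norm h) \<longlongrightarrow> 0) (at 0)"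
  proof (rule Lim_null_comparison)
    show "\<forall>\<^sub>F h in at 0. norm (norm (f (a + h) - f a - A h) / norm h) \<le> C * norm h"
    proof (rule eventually_at_ball[OF r, THEN eventually_mono])
      fix h :: "real^'d" assume "h \<in> ball 0 r \<and> h \<in> UNIV"
      then have "\<bar>f (a + h) - f a - A h\<bar> \<le> C * norm h * norm h"
        using approx[of h] by (simp add: diff_op_def abs_minus_commute power2_eq_square mult.assoc)
      then show "norm (norm (f (a + h) - f a - A h) / norm h) \<le> C * norm h"
        using C by (cases "h = 0") (auto simp: divide_le_eq)
    qed
    show "((\<lambda>h. C * norm h) \<longlongrightarrow> 0) (at 0)"
      by (auto intro!: tendsto_eq_intros)
  qed
  ultimately show ?thesis
    unfolding differentiable_def has_derivative_at by (auto simp: linear_conv_bounded_linear)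
qed

text \<open>
  This one-sided form suffices to pass bounds on differences to the limit of vanishing step.
\<close>

lemma derivative_bound_of_increments:
  fixes F :: "'a::real_normed_vector \<Rightarrow> real"
  assumes F: "(F has_derivative F') (at x)"
    and inc: "\<forall>\<^sub>F t in at_right 0. \<bar>F (x + t *\<^sub>R v) - F x\<bar> \<le> t * b"
  shows "\<bar>F' v\<bar> \<le> b"
proof -
  have "((\<lambda>t. F (x + t *\<^sub>R v)) has_derivative (\<lambda>t. F' (t *\<^sub>R v))) (at 0)"
    by (rule has_derivative_compose[of "\<lambda>t. x + t *\<^sub>R v"]) (use F in \<open>auto intro!: derivative_eq_intros\<close>)
  moreover have "(\<lambda>t. F' (t *\<^sub>R v)) = (*) (F' v)"
    using linear_scale[OF has_derivative_linear[OF F]] by (simp add: fun_eq_iff mult.commute)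
  ultimately have "((\<lambda>t. F (x + t *\<^sub>R v)) has_field_derivative F' v) (at 0)"
    by (simp add: has_field_derivative_def)
  then have "((\<lambda>t. (F (x + t *\<^sub>R v) - F x) / t) \<longlongrightarrow> F' v) (at_right 0)"
    by (auto simp: has_field_derivative_iff intro: filterlim_mono[OF _ order_refl at_le])
  then have "((\<lambda>t. \<bar>(F (x + t *\<^sub>R v) - F x) / t\<bar>) \<longlongrightarrow> \<bar>F' v\<bar>) (at_right 0)"
    by (rule tendsto_rabs)
  moreover have "\<forall>\<^sub>F t in at_right 0. \<bar>(F (x + t *\<^sub>R v) - F x) / t\<bar> \<le> b"
    using inc eventually_at_right_less[of 0]
    by eventually_elim (simp add: divide_le_eq mult.commute)
  ultimately show ?thesis
    by (intro tendsto_upperbound[where F = "at_right (0::real)"]) auto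
qed

section \<open>Induction on the order of the differences\<close>

definition fin_diff_bound ::
    "(real^'d \<Rightarrow> real) \<Rightarrow> nat \<Rightarrow> (real^'d) set \<Rightarrow> (real^'d \<Rightarrow> real) \<Rightarrow> real \<Rightarrow> bool" where
  "fin_diff_bound N k \<Omega> f M \<longleftrightarrow>
     (\<forall>us x. length us = k \<longrightarrow> x \<in> fin_diff_dom \<Omega> us \<longrightarrow> \<bar>fin_diff us f x\<bar> \<le> M * norm_prod N us)"

lemma is_norm_le_norm:
  fixes N :: "real^'d \<Rightarrow> real"
  assumes "is_norm N"
  obtains K where "0 \<le> K" "\<And>v. N v \<le> K * norm v"
proof
  have N: "N 0 = 0" "N (x + y) \<le> N x + N y" "N (c *\<^sub>R x) = \<bar>c\<bar> * N x" "0 \<le> N x" for x y c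
    using assms by (auto simp: is_norm_def)
  have N_sum: "N (sum g B) \<le> (\<Sum>b\<in>B. N (g b))" if "finite B" for g and B :: "(real^'d) set"
    using that by (induction B) (auto simp: N intro: order_trans[OF N(2)])
  show "0 \<le> (\<Sum>b\<in>Basis. N b)" by (simp add: sum_nonneg N)
  fix v :: "real^'d"
  have "N v \<le> (\<Sum>b\<in>Basis. N ((v \<bullet> b) *\<^sub>R b))"
    using N_sum[of Basis "\<lambda>b. (v \<bullet> b) *\<^sub>R b"] by (simp add: euclidean_representation)
  also have "\<dots> \<le> (\<Sum>b\<in>Basis. norm v * N b)"
    by (auto simp: N intro!: sum_mono mult_right_mono Basis_le_norm)
  finally show "N v \<le> (\<Sum>b\<in>Basis. N b) * norm v"
    by (simp add: sum_distrib_left mult.commute)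
qed

lemma fin_diff_bound_imp_local:
  assumes N: "is_norm N" and "open \<Omega>" "a \<in> \<Omega>" "fin_diff_bound N k \<Omega> f M" "0 \<le> M"
  shows "local_diff_bound k f a"
proof -
  obtain K where K: "0 \<le> K" "\<And>v. N v \<le> K * norm v"
    using is_norm_le_norm[OF N] by blast
  have N0: "0 \<le> N v" for v using N by (simp add: is_norm_def)
  have prod: "norm_prod N us \<le> K ^ length us * norm_prod norm us" for us
  proof (induction us)
    case (Cons u us)
    have "N u * norm_prod N us \<le> (K * norm u) * (K ^ length us * norm_prod norm us)"
      using Cons K N0 by (intro mult_mono) (auto simp: norm_prod_nonneg)
    then show ?case by (simp add: mult_ac)
  qed simp
  obtain r where r: "0 < r" "cball a r \<subseteq> \<Omega>"
    using \<open>open \<Omega>\<close> \<open>a \<in> \<Omega>\<close> open_contains_cball by blast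
  have "\<bar>fin_diff us f x\<bar> \<le> (M * K ^ k) * norm_prod norm us"
    if "length us = k" "dist a x + sum_list (map norm us) \<le> r" for us x
  proof -
    have "\<bar>fin_diff us f x\<bar> \<le> M * norm_prod N us"
      using assms(4) that cball_subset_fin_diff_dom[OF r(2) that(2)] by (simp add: fin_diff_bound_def)
    also have "\<dots> \<le> M * (K ^ k * norm_prod norm us)"
      using prod[of us] that(1) \<open>0 \<le> M\<close> by (intro mult_left_mono) auto
    finally show ?thesis by (simp add: mult.assoc)
  qed
  moreover have "0 \<le> M * K ^ k" using \<open>0 \<le> M\<close> K by simp
  ultimately show ?thesis
    using r(1) by (auto simp: local_diff_bound_def)
qed

lemma local_second_diff_bound:
  assumes "local_diff_bound 2 f a"
  shows "\<exists>C\<ge>0. \<exists>r>0. \<forall>u v. norm u + norm v \<le> r \<longrightarrow>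
    \<bar>diff_op u (diff_op v f) a\<bar> \<le> C * (norm u * norm v)"
proof -
  obtain C r where C: "0 \<le> C" "0 < r" and bd: "\<And>us x. length us = 2 \<Longrightarrow>
      dist a x + sum_list (map norm us) \<le> r \<Longrightarrow> \<bar>fin_diff us f x\<bar> \<le> C * norm_prod norm us"
    using assms by (auto simp: local_diff_bound_def)
  have "\<bar>diff_op u (diff_op v f) a\<bar> \<le> C * (norm u * norm v)" if "norm u + norm v \<le> r" for u v
    using bd[of "[u, v]" a] that by (simp add: fin_diff_def)
  with C show ?thesis by blast
qed

text \<open>
  The second difference with steps \<open>t v\<close> and \<open>w\<close> is the increment by \<open>t v\<close> of \<open>y \<mapsto> f(y + w) - f(y)\<close>.
  Dividing by \<open>t\<close> shows that the partial derivatives at \<open>a + w\<close> and \<open>a\<close> differ by at most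
  \<open>C \<parallel>v\<parallel> \<parallel>w\<parallel>\<close>.
\<close>

lemma frechet_derivative_continuous:
  fixes f :: "real^'d \<Rightarrow> real"
  assumes "open \<Omega>" "a \<in> \<Omega>" "\<And>x. x \<in> \<Omega> \<Longrightarrow> f differentiable (at x)" "local_diff_bound 2 f a"
  shows "isCont (\<lambda>x. frechet_derivative f (at x) v) a"
proof -
  let ?D = "\<lambda>x. frechet_derivative f (at x)"
  obtain C r where C: "0 \<le> C" "0 < r" and bd:
    "\<And>u v. norm u + norm v \<le> r \<Longrightarrow> \<bar>diff_op u (diff_op v f) a\<bar> \<le> C * (norm u * norm v)"
    using local_second_diff_bound[OF assms(4)] by blast
  have D: "(f has_derivative ?D x) (at x)" if "x \<in> \<Omega>" for x
    using assms(3)[OF that] by (simp flip: frechet_derivative_works)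
  have lip: "\<bar>?D (a + w) v - ?D a v\<bar> \<le> C * norm v * norm w" if w: "norm w < r" "a + w \<in> \<Omega>" for w
  proof -
    have F: "((\<lambda>y. f (y + w) - f y) has_derivative (\<lambda>v. ?D (a + w) v - ?D a v)) (at a)"
      using has_derivative_diff[OF has_derivative_compose[OF
          has_derivative_add_const[OF has_derivative_ident] D[OF w(2)]] D[OF \<open>a \<in> \<Omega>\<close>]] by simp
    have "((\<lambda>t. norm (t *\<^sub>R v) + norm w) \<longlongrightarrow> norm (0 *\<^sub>R v) + norm w) (at_right 0)"
      by (intro tendsto_intros)
    then have "\<forall>\<^sub>F t in at_right 0. norm (t *\<^sub>R v) + norm w < r"
      using w(1) by (auto dest: order_tendstoD(2))
    then have "\<forall>\<^sub>F t in at_right 0.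
        \<bar>(f (a + t *\<^sub>R v + w) - f (a + t *\<^sub>R v)) - (f (a + w) - f a)\<bar> \<le> t * (C * norm v * norm w)"
      using eventually_at_right_less[of 0]
    proof eventually_elim
      case (elim t)
      then show ?case using bd[of "t *\<^sub>R v" w] by (simp add: diff_op_def algebra_simps)
    qed
    then show ?thesis
      using derivative_bound_of_increments[OF F] by blast
  qed
  have "(\<lambda>w. ?D (a + w) v - ?D a v) \<midarrow>0\<rightarrow> 0"
  proof (rule Lim_null_comparison)
    obtain s where s: "0 < s" "ball a s \<subseteq> \<Omega>"
      using assms(1,2) open_contains_ball by blast
    show "\<forall>\<^sub>F w in at 0. norm (?D (a + w) v - ?D a v) \<le> C * norm v * norm w"
      using eventually_at_ball[of "min r s" 0 UNIV]
    proof (rule eventually_mono)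
      fix w :: "real^'d" assume "w \<in> ball 0 (min r s) \<and> w \<in> UNIV"
      then show "norm (?D (a + w) v - ?D a v) \<le> C * norm v * norm w"
        using lip[of w] s by (auto simp: subset_iff dist_norm)
    qed (use C s in auto)
    show "((\<lambda>w. C * norm v * norm w) \<longlongrightarrow> 0) (at 0)"
      by (auto intro!: tendsto_eq_intros)
  qed
  then show ?thesis
    by (simp add: isCont_def LIM_offset_zero_iff Lim_null[of _ "?D a v"])
qed

text \<open>
  Differencing commutes with differentiation, so \<open>\<Delta>_u \<partial>_v f\<close> is the limit of \<open>\<Delta>_u \<Delta>_{tv} f / t\<close>,
  where the bound of order \<open>k + 1\<close> contributes the factor \<open>N(t v) / t = N(v)\<close>.
\<close>

lemma fin_diff_bound_derivative:
  assumes N: "is_norm N" and "open \<Omega>" and bd: "fin_diff_bound N (Suc k) \<Omega> f M"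
    and D: "\<And>y. y \<in> \<Omega> \<Longrightarrow> f differentiable (at y)"
  shows "fin_diff_bound N k \<Omega> (\<lambda>y. frechet_derivative f (at y) v) (M * N v)"
  unfolding fin_diff_bound_def
proof (intro allI impI)
  fix us :: "(real^'a) list" and x assume us: "length us = k" and x: "x \<in> fin_diff_dom \<Omega> us"
  have f': "(f has_derivative frechet_derivative f (at y)) (at y)" if "y \<in> \<Omega>" for y
    using D[OF that] by (simp flip: frechet_derivative_works)
  have "((\<lambda>t. x + t *\<^sub>R v) \<longlongrightarrow> x + 0 *\<^sub>R v) (at_right 0)"
    by (intro tendsto_intros)
  then have "\<forall>\<^sub>F t in at_right 0. x + t *\<^sub>R v \<in> fin_diff_dom \<Omega> us"
    using x open_fin_diff_dom[OF \<open>open \<Omega>\<close>] by (auto dest: topological_tendstoD)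
  then have "\<forall>\<^sub>F t in at_right 0.
      \<bar>fin_diff us f (x + t *\<^sub>R v) - fin_diff us f x\<bar> \<le> t * (M * N v * norm_prod N us)"
    using eventually_at_right_less[of 0]
  proof eventually_elim
    case (elim t)
    then have "\<bar>fin_diff (us @ [t *\<^sub>R v]) f x\<bar> \<le> M * norm_prod N (us @ [t *\<^sub>R v])"
      using us x by (intro bd[unfolded fin_diff_bound_def, rule_format]) (auto simp: fin_diff_dom_snoc)
    moreover have "N (t *\<^sub>R v) = t * N v"
      using N elim by (simp add: is_norm_def)
    ultimately show ?case
      by (simp add: fin_diff_middle diff_op_def mult_ac)
  qed
  then show "\<bar>fin_diff us (\<lambda>y. frechet_derivative f (at y) v) x\<bar> \<le> M * N v * norm_prod N us"
    using derivative_bound_of_increments[OF fin_diff_has_derivative[OF f' x]] by blast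
qed

lemma class_C_Suc:
  assumes "\<And>x. x \<in> \<Omega> \<Longrightarrow> f differentiable (at x)"
    and "\<And>v. class_C m \<Omega> (\<lambda>y. frechet_derivative f (at y) v)"
  shows "class_C (Suc m) \<Omega> f"
  unfolding class_C_def
proof (intro conjI allI impI ballI)
  fix j and us :: "(real^'a) list" and x assume "j < Suc m" "length us = j" "x \<in> \<Omega>"
  then show "(\<lambda>y. iter_deriv f y us) differentiable (at x)"
    using assms unfolding class_C_def
    by (cases us rule: rev_cases) (auto simp: iter_deriv_append)
next
  fix us :: "(real^'a) list" assume "length us = Suc m"
  then show "continuous_on \<Omega> (\<lambda>y. iter_deriv f y us)"
    using assms unfolding class_C_def
    by (cases us rule: rev_cases) (auto simp: iter_deriv_append)
qed

text \<open>
  The induction descends to the partial derivatives of \<open>f\<close>; the constant must vary, as it is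
  \<open>M N(v)\<close> for \<open>\<partial>_v f\<close>. For \<open>m = 0\<close> the bound is the Lipschitz condition itself.
\<close>

lemma fin_diff_bound_imp_class_C:
  assumes N: "is_norm N" and "open \<Omega>"
  shows "fin_diff_bound N (Suc m) \<Omega> f M \<Longrightarrow> 0 \<le> M \<Longrightarrow> continuous_on \<Omega> f \<Longrightarrow>
    class_C m \<Omega> f \<and> (\<forall>us. length us = m \<longrightarrow> (\<forall>x\<in>\<Omega>. \<forall>y\<in>\<Omega>.
      \<bar>iter_deriv f x us - iter_deriv f y us\<bar> \<le> M * N (x - y) * norm_prod N us))"
proof (induction m arbitrary: f M)
  case 0
  have "\<bar>f x - f y\<bar> \<le> M * N (x - y)" if "x \<in> \<Omega>" "y \<in> \<Omega>" for x y
    using 0(1)[unfolded fin_diff_bound_def, rule_format, of "[x - y]" y] that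
    by (simp add: fin_diff_dom_Cons fin_diff_dom_Nil fin_diff_Cons)
  then show ?case using 0(3) by (simp add: class_C_def)
next
  case (Suc m)
  have cont: "isCont f a" if "a \<in> \<Omega>" for a
    using that Suc.prems(3) \<open>open \<Omega>\<close> by (simp add: continuous_on_eq_continuous_at)
  have loc: "local_diff_bound 2 f a" if "a \<in> \<Omega>" for a
    by (rule local_diff_bound_antimono[OF _
          fin_diff_bound_imp_local[OF N \<open>open \<Omega>\<close> that Suc.prems(1,2)] cont[OF that]]) simp
  have D: "f differentiable (at a)" if a: "a \<in> \<Omega>" for a
  proof -
    obtain C r where "0 \<le> C" "0 < r"
      "\<And>u v. norm u + norm v \<le> r \<Longrightarrow> \<bar>diff_op u (diff_op v f) a\<bar> \<le> C * (norm u * norm v)"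
      using local_second_diff_bound[OF loc[OF a]] by blast
    then show ?thesis
      using cont[OF a] by (rule second_diff_bound_imp_differentiable)
  qed
  have cont': "continuous_on \<Omega> (\<lambda>y. frechet_derivative f (at y) v)" for v
    using frechet_derivative_continuous[OF \<open>open \<Omega>\<close> _ D loc] \<open>open \<Omega>\<close>
    by (simp add: continuous_on_eq_continuous_at)
  have N0: "0 \<le> N v" for v using N by (simp add: is_norm_def)
  have IH: "class_C m \<Omega> (\<lambda>y. frechet_derivative f (at y) v) \<and>
      (\<forall>us. length us = m \<longrightarrow> (\<forall>x\<in>\<Omega>. \<forall>y\<in>\<Omega>.
        \<bar>iter_deriv (\<lambda>y. frechet_derivative f (at y) v) x us
         - iter_deriv (\<lambda>y. frechet_derivative f (at y) v) y us\<bar> \<le> M * N v * N (x - y) * norm_prod N us))"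
    for v
    using fin_diff_bound_derivative[OF N \<open>open \<Omega>\<close> Suc.prems(1) D, of v] Suc.prems(2) N0 cont'
    by (intro Suc.IH) auto
  show ?case
  proof (intro conjI allI impI ballI)
    show "class_C (Suc m) \<Omega> f" using D IH by (blast intro: class_C_Suc)
    fix us :: "(real^'a) list" and x y assume *: "length us = Suc m" "x \<in> \<Omega>" "y \<in> \<Omega>"
    then obtain vs v where "us = vs @ [v]" "length vs = m"
      by (metis length_Suc_conv_rev)
    then show "\<bar>iter_deriv f x us - iter_deriv f y us\<bar> \<le> M * N (x - y) * norm_prod N us"
      using IH[of v] * by (auto simp: iter_deriv_append mult_ac)
  qed
qed

section \<open>Optimal constants\<close>

lemma norm_prod_pos: "is_norm N \<Longrightarrow> us \<in> nonzero_tuples m \<Longrightarrow> 0 < norm_prod N us"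
  by (induction us arbitrary: m) (auto simp: nonzero_tuples_def is_norm_def less_le)

lemma is_lipschitz_const_iff:
  assumes "is_norm N"
  shows "is_lipschitz_const N m \<Omega> G L \<longleftrightarrow> 0 \<le> L \<and>
    (\<forall>us\<in>nonzero_tuples m. \<forall>x\<in>\<Omega>. \<forall>y\<in>\<Omega>. \<bar>G x us - G y us\<bar> \<le> L * N (x - y) * norm_prod N us)"
proof -
  have "ennreal (\<bar>G x us - G y us\<bar> / norm_prod N us) \<le> ennreal (L * N (x - y)) \<longleftrightarrow>
      \<bar>G x us - G y us\<bar> \<le> L * N (x - y) * norm_prod N us"
    if "us \<in> nonzero_tuples m" "0 \<le> L" for us x y
    using that assms norm_prod_pos[OF assms that(1)]
    by (subst ennreal_le_iff) (auto simp: is_norm_def pos_divide_le_eq)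
  then show ?thesis
    by (auto simp: is_lipschitz_const_def multilin_norm_def SUP_le_iff)
qed

text \<open>
  The supremum only runs over tuples of nonzero vectors, but a difference with a zero step vanishes,
  so the bound extends to all tuples.
\<close>

lemma fin_diff_norm_le_iff:
  assumes "is_norm N" "0 \<le> M"
  shows "fin_diff_norm N k \<Omega> f \<le> ennreal M \<longleftrightarrow> fin_diff_bound N k \<Omega> f M"
proof -
  have "ennreal (1 / norm_prod N us) * ennreal \<bar>fin_diff us f x\<bar> \<le> ennreal M \<longleftrightarrow>
      \<bar>fin_diff us f x\<bar> \<le> M * norm_prod N us" if "us \<in> nonzero_tuples k" for us x
  proof -
    note pos = norm_prod_pos[OF assms(1) that]
    then have "ennreal (1 / norm_prod N us) * ennreal \<bar>fin_diff us f x\<bar>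
        = ennreal (\<bar>fin_diff us f x\<bar> / norm_prod N us)"
      by (simp flip: ennreal_mult')
    then show ?thesis
      using assms(2) pos by (simp add: pos_divide_le_eq)
  qed
  then have "fin_diff_norm N k \<Omega> f \<le> ennreal M \<longleftrightarrow>
      (\<forall>us\<in>nonzero_tuples k. \<forall>x\<in>fin_diff_dom \<Omega> us. \<bar>fin_diff us f x\<bar> \<le> M * norm_prod N us)"
    by (simp add: fin_diff_norm_def SUP_mult_left_ennreal SUP_le_iff)
  also have "\<dots> \<longleftrightarrow> fin_diff_bound N k \<Omega> f M"
  proof -
    have "\<bar>fin_diff us f x\<bar> \<le> M * norm_prod N us" if "0 \<in> set us" for us x
      using that assms by (simp add: fin_diff_zero_direction norm_prod_nonneg is_norm_def)
    then show ?thesis by (auto simp: fin_diff_bound_def nonzero_tuples_def)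
  qed
  finally show ?thesis .
qed

lemma lipschitz_imp_fin_diff_bound:
  assumes N: "is_norm N" and "convex \<Omega>" and C: "class_C m \<Omega> f"
    and L: "is_lipschitz_const N m \<Omega> (iter_deriv f) L"
  shows "fin_diff_bound N (Suc m) \<Omega> f L"
  unfolding fin_diff_bound_def
proof (intro allI impI)
  fix us :: "(real^'a) list" and x assume us: "length us = Suc m" and x: "x \<in> fin_diff_dom \<Omega> us"
  have L0: "0 \<le> L" and N0: "0 \<le> N v" for v
    using L N by (auto simp: is_lipschitz_const_def is_norm_def)
  show "\<bar>fin_diff us f x\<bar> \<le> L * norm_prod N us"
  proof (cases "0 \<in> set us")
    case True
    then show ?thesis using L0 N0 by (simp add: fin_diff_zero_direction norm_prod_nonneg)
  next
    case False
    obtain w vs where w: "us = w # vs" "length vs = m"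
      using us by (metis length_Suc_conv)
    then have "x \<in> fin_diff_dom \<Omega> vs" "x + w \<in> fin_diff_dom \<Omega> vs"
      using x by (auto simp: fin_diff_dom_Cons)
    then obtain z where z: "z \<in> \<Omega>" "z + w \<in> \<Omega>"
      "fin_diff us f x = iter_deriv f (z + w) (rev vs) - iter_deriv f z (rev vs)"
      using fin_diff_mean_value[OF \<open>convex \<Omega>\<close>, of vs f x w] C w
      by (auto simp: class_C_def fin_diff_Cons)
    have "rev vs \<in> nonzero_tuples m"
      using w False by (auto simp: nonzero_tuples_def)
    then have "\<bar>fin_diff us f x\<bar> \<le> L * N ((z + w) - z) * norm_prod N (rev vs)"
      using L z unfolding is_lipschitz_const_iff[OF N] by metis
    then show ?thesis using w by (simp add: mult.assoc)
  qed
qed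

lemma fin_diff_norm_le_iff_lipschitz:
  assumes N: "is_norm N" and "open \<Omega>" "convex \<Omega>" "continuous_on \<Omega> f" "0 \<le> M"
  shows "fin_diff_norm N (Suc m) \<Omega> f \<le> ennreal M \<longleftrightarrow>
    class_C m \<Omega> f \<and> is_lipschitz_const N m \<Omega> (iter_deriv f) M"
proof -
  have "is_lipschitz_const N m \<Omega> (iter_deriv f) M" "class_C m \<Omega> f" if "fin_diff_bound N (Suc m) \<Omega> f M"
    using fin_diff_bound_imp_class_C[OF N \<open>open \<Omega>\<close> that assms(5,4)] assms(5)
    by (auto simp: is_lipschitz_const_iff[OF N] nonzero_tuples_def)
  then show ?thesis
    using lipschitz_imp_fin_diff_bound[OF N \<open>convex \<Omega>\<close>] fin_diff_norm_le_iff[OF N \<open>0 \<le> M\<close>] by blast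
qed

theorem theoremB:
  fixes N :: "real^'d \<Rightarrow> real"
    and k :: nat
    and \<Omega> :: "(real^'d) set"
    and f :: "real^'d \<Rightarrow> real"
  assumes "is_norm N"
    and "k \<ge> 1"
    and "open \<Omega>"
    and "convex \<Omega>"
    and "continuous_on \<Omega> f"
  shows "(fin_diff_norm N k \<Omega> f < \<infinity> \<longleftrightarrow>
            class_C (k - 1) \<Omega> f \<and> is_lipschitz N (k - 1) \<Omega> (iter_deriv f)) \<and>
         (fin_diff_norm N k \<Omega> f < \<infinity> \<longrightarrow>
            fin_diff_norm N k \<Omega> f = Lip N (k - 1) \<Omega> (iter_deriv f))"
proof -
  let ?A = "fin_diff_norm N k \<Omega> f" and ?lip = "is_lipschitz_const N (k - 1) \<Omega> (iter_deriv f)"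
  have key: "?A \<le> ennreal M \<longleftrightarrow> class_C (k - 1) \<Omega> f \<and> ?lip M" if "0 \<le> M" for M
    using fin_diff_norm_le_iff_lipschitz[OF assms(1,3-5) that, of "k - 1"] \<open>k \<ge> 1\<close> by simp
  have nonneg: "0 \<le> L" if "?lip L" for L
    using that by (simp add: is_lipschitz_const_def)
  have finite: "?A < \<infinity> \<longleftrightarrow> (\<exists>M\<ge>0. ?A \<le> ennreal M)"
    by (cases ?A) (auto simp: top_unique)
  have "?A < \<infinity> \<longleftrightarrow> class_C (k - 1) \<Omega> f \<and> is_lipschitz N (k - 1) \<Omega> (iter_deriv f)"
    unfolding finite is_lipschitz_def using key nonneg by blast
  moreover have "?A = Lip N (k - 1) \<Omega> (iter_deriv f)" if fin: "?A < \<infinity>"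
  proof (rule antisym)
    obtain M where M: "0 \<le> M" "?A = ennreal M"
      using fin by (cases ?A) auto
    then have "class_C (k - 1) \<Omega> f" "?lip M" using key[of M] by auto
    then show "Lip N (k - 1) \<Omega> (iter_deriv f) \<le> ?A"
      unfolding Lip_def M(2) by (intro INF_lower) simp
    show "?A \<le> Lip N (k - 1) \<Omega> (iter_deriv f)"
      unfolding Lip_def using \<open>class_C (k - 1) \<Omega> f\<close> key nonneg by (auto intro!: INF_greatest)
  qed
  ultimately show ?thesis by blast
qed

end
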